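(* Let $\{X,\phi_i\}$ and $\{Z,\psi_i\}$ be two fundamental limit spaces for the closed injective system $\{X_i,Y_i,f_i\}$. Let $\beta:X\to Z$ be the (existing and unique) bijection such that $\psi_i=\beta\circ\phi_i$ for all $i\in\mathbb{N}$. Then $\beta$ is a homeomorphism. Moreover, $\beta$ is the unique homeomorphism from $X$ onto $Z$ such that $\psi_i=\beta\circ\phi_i$ for all $i\in\mathbb{N}$.
   Context: $\mathbb{N}=\{0,1,2,\dots\}$. A closed injective system (CIS) $\{X_i,Y_i,f_i\}$ consists, for each $i\in\mathbb{N}$, of a nonempty topological space $X_i$, a closed subspace $Y_i\subset X_i$ and a closed injective continuous map $f_i:Y_i\to X_{i+1}$. Semicomponibility. Each $f_i$ is semicomponible with itself; put $Y_{i,i}=Y_i$, $f_{i,i}=f_i$. For $j>i$, inductively, $f_i$ and $f_j$ are semicomponible if $f_i$ and $f_{j-1}$ are semicomponible and $f_{i,j-1}(Y_{i,j-1})\cap Y_j\neq\emptyset$; in that case $Y_{i,j}=f_{i,j-1}^{-1}(Y_j)$ and $f_{i,j}:Y_{i,j}\to X_{j+1}$ is $f_{i,j}(y)=f_j(f_{i,j-1}(y))$. A limit space for the CIS is a topological space $X$ with continuous maps $\phi_i:X_i\to X$ ($i\in\mathbb{N}$) such that: (1) $X=\bigcup_{i}\phi_i(X_i)$; (2) each $\phi_i$ is an embedding (a homeomorphism onto its image); (3) if $i<j$ and $f_i$, $f_{j-1}$ are semicomponible, then $\phi_i(X_i)\cap\phi_j(X_j)=\phi_j(f_{i,j-1}(Y_{i,j-1}))$,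 and whenever $\phi_i(x_i)=\phi_j(x_j)$ with $x_i\in X_i$, $x_j\in X_j$, one has $x_i\in Y_{i,j-1}$ and $x_j=f_{i,j-1}(x_i)$; (4) if $i<j$ and $f_i$, $f_{j-1}$ are not semicomponible, then $\phi_i(X_i)\cap\phi_j(X_j)=\emptyset$. A fundamental limit space is a limit space $\{X,\phi_i\}$ such that $X$ has the weak topology: a subset $A\subset X$ is closed in $X$ if and only if $\phi_i^{-1}(A)$ is closed in $X_i$ for all $i\in\mathbb{N}$. *)

theory Defs
  imports "HOL-Analysis.Analysis"
begin

text \<open>
  The spaces \<open>X i\<close> are topologies whose carriers \<open>topspace (X i)\<close> lie in one common type;
  only the values of \<open>f i\<close> on \<open>Y i\<close> are relevant.
\<close>

definition closed_injective_system ::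
    "(nat \<Rightarrow> 'a topology) \<Rightarrow> (nat \<Rightarrow> 'a set) \<Rightarrow> (nat \<Rightarrow> 'a \<Rightarrow> 'a) \<Rightarrow> bool" where
  "closed_injective_system X Y f \<longleftrightarrow>
     (\<forall>i. topspace (X i) \<noteq> {} \<and>
          closedin (X i) (Y i) \<and>
          continuous_map (subtopology (X i) (Y i)) (X (Suc i)) (f i) \<and>
          closed_map (subtopology (X i) (Y i)) (X (Suc i)) (f i) \<and>
          inj_on (f i) (Y i))"

text \<open>
  \<open>cis_map f i j\<close> is $f_{i,j}$ and \<open>cis_dom Y f i j\<close> is $Y_{i,j}$. Both are total in the
  indices; the values for \<open>j < i\<close> are junk, and semicomponibility (below) fails there.
\<close>

primrec cis_map :: "(nat \<Rightarrow> 'a \<Rightarrow> 'a) \<Rightarrow> nat \<Rightarrow> nat \<Rightarrow> 'a \<Rightarrow> 'a" where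
  "cis_map f i 0 = f i"
| "cis_map f i (Suc j) = (if Suc j \<le> i then f i else (\<lambda>y. f (Suc j) (cis_map f i j y)))"

primrec cis_dom :: "(nat \<Rightarrow> 'a set) \<Rightarrow> (nat \<Rightarrow> 'a \<Rightarrow> 'a) \<Rightarrow> nat \<Rightarrow> nat \<Rightarrow> 'a set" where
  "cis_dom Y f i 0 = Y i"
| "cis_dom Y f i (Suc j) =
     (if Suc j \<le> i then Y i else {y \<in> cis_dom Y f i j. cis_map f i j y \<in> Y (Suc j)})"

lemma cis_map_same: "cis_map f i i = f i"
  by (cases i) simp_all

lemma cis_map_step: "i \<le> j \<Longrightarrow> cis_map f i (Suc j) y = f (Suc j) (cis_map f i j y)"
  by simp

lemma cis_dom_same: "cis_dom Y f i i = Y i"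
  by (cases i) simp_all

lemma cis_dom_step:
  "i \<le> j \<Longrightarrow> cis_dom Y f i (Suc j) = {y \<in> cis_dom Y f i j. cis_map f i j y \<in> Y (Suc j)}"
  by simp

inductive semicomponible ::
    "(nat \<Rightarrow> 'a set) \<Rightarrow> (nat \<Rightarrow> 'a \<Rightarrow> 'a) \<Rightarrow> nat \<Rightarrow> nat \<Rightarrow> bool"
  for Y f where
  same: "semicomponible Y f i i"
| step: "semicomponible Y f i j \<Longrightarrow> cis_map f i j ` cis_dom Y f i j \<inter> Y (Suc j) \<noteq> {}
         \<Longrightarrow> semicomponible Y f i (Suc j)"

definition limit_space ::
    "(nat \<Rightarrow> 'a topology) \<Rightarrow> (nat \<Rightarrow> 'a set) \<Rightarrow> (nat \<Rightarrow> 'a \<Rightarrow> 'a) \<Rightarrow>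
     'b topology \<Rightarrow> (nat \<Rightarrow> 'a \<Rightarrow> 'b) \<Rightarrow> bool" where
  "limit_space X Y f L \<phi> \<longleftrightarrow>
     (\<forall>i. continuous_map (X i) L (\<phi> i)) \<and>
     topspace L = (\<Union>i. \<phi> i ` topspace (X i)) \<and>
     (\<forall>i. embedding_map (X i) L (\<phi> i)) \<and>
     (\<forall>i j. i < j \<and> semicomponible Y f i (j - 1) \<longrightarrow>
        \<phi> i ` topspace (X i) \<inter> \<phi> j ` topspace (X j)
          = \<phi> j ` cis_map f i (j - 1) ` cis_dom Y f i (j - 1) \<and>
        (\<forall>x\<in>topspace (X i). \<forall>x'\<in>topspace (X j). \<phi> i x = \<phi> j x' \<longrightarrow>
           x \<in> cis_dom Y f i (j - 1) \<and> x' = cis_map f i (j - 1) x)) \<and>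
     (\<forall>i j. i < j \<and> \<not> semicomponible Y f i (j - 1) \<longrightarrow>
        \<phi> i ` topspace (X i) \<inter> \<phi> j ` topspace (X j) = {})"

definition fundamental_limit_space ::
    "(nat \<Rightarrow> 'a topology) \<Rightarrow> (nat \<Rightarrow> 'a set) \<Rightarrow> (nat \<Rightarrow> 'a \<Rightarrow> 'a) \<Rightarrow>
     'b topology \<Rightarrow> (nat \<Rightarrow> 'a \<Rightarrow> 'b) \<Rightarrow> bool" where
  "fundamental_limit_space X Y f L \<phi> \<longleftrightarrow>
     limit_space X Y f L \<phi> \<and>
     (\<forall>A. A \<subseteq> topspace L \<longrightarrow>
        (closedin L A \<longleftrightarrow> (\<forall>i. closedin (X i) {x \<in> topspace (X i). \<phi> i x \<in> A})))"

end

theory Submission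
  imports Defs
begin

text \<open>
  The axioms of a limit space determine, from the system alone, when a point of \<open>X i\<close> and a
  point of \<open>X j\<close> have the same image. Hence any two limit spaces make the same identifications
  on the disjoint union of the \<open>X i\<close>, which gives the bijection \<open>\<beta>\<close>, and the traces on the
  \<open>X i\<close> of a set \<open>A\<close> and of its image under \<open>\<beta>\<close> agree, so the weak topologies correspond.
\<close>

text \<open>A composite of injective maps: points of \<open>cis_dom Y f i (Suc j)\<close> are sent
  by \<open>cis_map f i j\<close> into \<open>Y (Suc j)\<close>, where \<open>f (Suc j)\<close> is
  injective.\<close>

lemma inj_on_cis_map:
  assumes "closed_injective_system X Y f" and "i \<le> j"
  shows "inj_on (cis_map f i j) (cis_dom Y f i j)"
  using assms(2)
proof (induction j rule: dec_induct)
  case base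
  then show ?case
    using assms(1) by (simp add: closed_injective_system_def cis_map_same cis_dom_same)
next
  case (step j)
  have "inj_on (f (Suc j)) (Y (Suc j))"
    using assms(1) by (simp add: closed_injective_system_def)
  with step show ?case
    by (auto simp: inj_on_def)
qed

lemma limit_space_topspace:
  "limit_space X Y f L \<phi> \<Longrightarrow> topspace L = (\<Union>i. \<phi> i ` topspace (X i))"
  by (simp add: limit_space_def)

lemma limit_space_inj_on:
  "limit_space X Y f L \<phi> \<Longrightarrow> inj_on (\<phi> i) (topspace (X i))"
  using homeomorphic_imp_injective_map by (fastforce simp: limit_space_def embedding_map_def)

text \<open>The right-hand side mentions only the system, so it is the same for every limit space.
  The index \<open>j - 1\<close> occurs because \<open>cis_map f i (j - 1)\<close> is the composite
  that lands in \<open>X j\<close>.\<close>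

lemma limit_space_eq_iff:
  assumes cis: "closed_injective_system X Y f" and lim: "limit_space X Y f L \<phi>"
    and "i < j" and x: "x \<in> topspace (X i)" and x': "x' \<in> topspace (X j)"
  shows "\<phi> i x = \<phi> j x' \<longleftrightarrow> semicomponible Y f i (j - 1) \<and>
           x \<in> cis_dom Y f i (j - 1) \<and> x' = cis_map f i (j - 1) x"
proof (cases "semicomponible Y f i (j - 1)")
  case False
  then have "\<phi> i ` topspace (X i) \<inter> \<phi> j ` topspace (X j) = {}"
    using lim \<open>i < j\<close> by (simp add: limit_space_def)
  with False x x' show ?thesis by auto
next
  case True
  then have meet: "\<phi> i ` topspace (X i) \<inter> \<phi> j ` topspace (X j)
      = \<phi> j ` cis_map f i (j - 1) ` cis_dom Y f i (j - 1)"
    using lim \<open>i < j\<close> by (simp add: limit_space_def)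
  \<comment> \<open>Stated for every \<open>y\<close>: it is applied to \<open>x\<close> for one
    direction, and to an auxiliary preimage for the other.\<close>
  have glued: "y \<in> cis_dom Y f i (j - 1) \<and> x' = cis_map f i (j - 1) y"
    if "y \<in> topspace (X i)" "\<phi> i y = \<phi> j x'" for y
    using lim True \<open>i < j\<close> x' that unfolding limit_space_def by blast
  have "\<phi> i x = \<phi> j x'" if "x \<in> cis_dom Y f i (j - 1)" "x' = cis_map f i (j - 1) x"
  proof -
    \<comment> \<open>The intersection formula only yields some \<open>y\<close> in
      \<open>X i\<close> with the same image as \<open>x'\<close>; injectivity of the composite
      identifies it with \<open>x\<close>.\<close>
    have "\<phi> j x' \<in> \<phi> i ` topspace (X i)"
      using meet that by blast
    then obtain y where y: "y \<in> topspace (X i)" "\<phi> i y = \<phi> j x'"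
      by (metis imageE)
    have "inj_on (cis_map f i (j - 1)) (cis_dom Y f i (j - 1))"
      using cis \<open>i < j\<close> by (intro inj_on_cis_map) auto
    then have "y = x"
      using glued[OF y] that by (simp add: inj_on_def)
    with y show ?thesis by simp
  qed
  with True glued x show ?thesis by blast
qed

lemma limit_spaces_same_identifications:
  assumes cis: "closed_injective_system X Y f"
    and L: "limit_space X Y f L \<phi>" and Z: "limit_space X Y f Z \<psi>"
    and x: "x \<in> topspace (X i)" and x': "x' \<in> topspace (X j)"
  shows "\<phi> i x = \<phi> j x' \<longleftrightarrow> \<psi> i x = \<psi> j x'"
proof (cases i j rule: linorder_cases)
  case less
  then show ?thesis
    by (simp add: limit_space_eq_iff[OF cis L _ x x'] limit_space_eq_iff[OF cis Z _ x x'])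
next
  case equal
  then show ?thesis
    using x x' inj_on_eq_iff[OF limit_space_inj_on[OF L]] inj_on_eq_iff[OF limit_space_inj_on[OF Z]]
    by blast
next
  case greater
  then show ?thesis
    using limit_space_eq_iff[OF cis L _ x' x] limit_space_eq_iff[OF cis Z _ x' x] by metis
qed

text \<open>Sending \<open>\<phi> i x\<close> to \<open>\<psi> i x\<close> is well defined by one
  direction of the equivalence of identifications and injective by the other; it is onto because the
  images of the \<open>\<psi> i\<close> cover \<open>Z\<close>.\<close>

lemma limit_spaces_bijection_exists:
  assumes cis: "closed_injective_system X Y f"
    and L: "limit_space X Y f L \<phi>" and Z: "limit_space X Y f Z \<psi>"
  shows "\<exists>\<beta>. \<beta> \<in> extensional (topspace L) \<and> bij_betw \<beta> (topspace L) (topspace Z) \<and>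
    (\<forall>i. \<forall>x\<in>topspace (X i). \<psi> i x = \<beta> (\<phi> i x))"
proof -
  note same = limit_spaces_same_identifications[OF cis L Z]
  \<comment> \<open>Off \<open>topspace L\<close> the condition on \<open>z\<close> is vacuous, so a
    total function \<open>g\<close> can be chosen.\<close>
  have "\<exists>z. \<forall>i. \<forall>x\<in>topspace (X i). \<phi> i x = p \<longrightarrow> \<psi> i x = z" for p
  proof (cases "p \<in> topspace L")
    case True
    then obtain j y where "y \<in> topspace (X j)" "p = \<phi> j y"
      by (auto simp: limit_space_topspace[OF L])
    then show ?thesis
      using same by blast
  qed (auto simp: limit_space_topspace[OF L])
  then obtain g where g: "\<And>i x. x \<in> topspace (X i) \<Longrightarrow> \<psi> i x = g (\<phi> i x)"
    by metis
  have "inj_on g (topspace L)"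
  proof (rule inj_onI)
    fix p q assume "p \<in> topspace L" "q \<in> topspace L" "g p = g q"
    then obtain i x j y where "x \<in> topspace (X i)" "p = \<phi> i x" "y \<in> topspace (X j)" "q = \<phi> j y"
      by (auto simp: limit_space_topspace[OF L])
    with \<open>g p = g q\<close> show "p = q"
      using g same by metis
  qed
  moreover have "g ` topspace L = topspace Z"
    by (simp add: limit_space_topspace[OF L] limit_space_topspace[OF Z] image_UN image_image g)
  \<comment> \<open>Restricting fixes the irrelevant values of \<open>g\<close> off
    \<open>topspace L\<close>, which makes the map extensional.\<close>
  ultimately have "bij_betw (restrict g (topspace L)) (topspace L) (topspace Z)"
    by (simp add: bij_betw_def)
  moreover have "\<psi> i x = restrict g (topspace L) (\<phi> i x)" if "x \<in> topspace (X i)" for i x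
    using that g limit_space_topspace[OF L] by auto
  ultimately show ?thesis
    by (intro exI[of _ "restrict g (topspace L)"]) simp
qed

text \<open>A set \<open>B\<close> in \<open>Z\<close> and its preimage under \<open>\<beta>\<close>
  have the same trace on each \<open>X i\<close>, so the two weak topologies test the same sets for
  closedness. Hence \<open>\<beta>\<close> is a quotient map, and an injective quotient map is a
  homeomorphism.\<close>

lemma fundamental_limit_spaces_homeomorphic_map:
  assumes L: "fundamental_limit_space X Y f L \<phi>" and Z: "fundamental_limit_space X Y f Z \<psi>"
    and bij: "bij_betw \<beta> (topspace L) (topspace Z)"
    and comm: "\<And>i x. x \<in> topspace (X i) \<Longrightarrow> \<psi> i x = \<beta> (\<phi> i x)"
  shows "homeomorphic_map L Z \<beta>"
proof -
  have "closedin L {p \<in> topspace L. \<beta> p \<in> B} \<longleftrightarrow> closedin Z B" if "B \<subseteq> topspace Z" for B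
  proof -
    have "\<phi> i x \<in> topspace L" if "x \<in> topspace (X i)" for i x
      using L that limit_space_topspace[of X Y f L \<phi>] by (auto simp: fundamental_limit_space_def)
    then have "{x \<in> topspace (X i). \<phi> i x \<in> {p \<in> topspace L. \<beta> p \<in> B}}
        = {x \<in> topspace (X i). \<psi> i x \<in> B}" for i
      by (auto simp: comm)
    then show ?thesis
      using L Z that by (simp add: fundamental_limit_space_def)
  qed
  then show ?thesis
    using bij by (simp add: homeomorphic_map_def quotient_map_closedin bij_betw_def)
qed

theorem theorem3p5:
  fixes X :: "nat \<Rightarrow> 'a topology" and Y :: "nat \<Rightarrow> 'a set" and f :: "nat \<Rightarrow> 'a \<Rightarrow> 'a"
    and L :: "'b topology" and \<phi> :: "nat \<Rightarrow> 'a \<Rightarrow> 'b"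
    and Z :: "'c topology" and \<psi> :: "nat \<Rightarrow> 'a \<Rightarrow> 'c"
  assumes "closed_injective_system X Y f"
    and "fundamental_limit_space X Y f L \<phi>"
    and "fundamental_limit_space X Y f Z \<psi>"
  shows "(\<exists>!\<beta>. \<beta> \<in> extensional (topspace L) \<and>
               bij_betw \<beta> (topspace L) (topspace Z) \<and>
               (\<forall>i. \<forall>x\<in>topspace (X i). \<psi> i x = \<beta> (\<phi> i x))) \<and>
         (\<forall>\<beta>. bij_betw \<beta> (topspace L) (topspace Z) \<and>
               (\<forall>i. \<forall>x\<in>topspace (X i). \<psi> i x = \<beta> (\<phi> i x)) \<longrightarrow>
               homeomorphic_map L Z \<beta> \<and>
               (\<forall>\<gamma>. homeomorphic_map L Z \<gamma> \<and>
                     (\<forall>i. \<forall>x\<in>topspace (X i). \<psi> i x = \<gamma> (\<phi> i x)) \<longrightarrow>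
                     (\<forall>x\<in>topspace L. \<gamma> x = \<beta> x)))"
proof -
  note cis = assms(1)
  have L: "limit_space X Y f L \<phi>" and Z: "limit_space X Y f Z \<psi>"
    using assms by (auto simp: fundamental_limit_space_def)
  \<comment> \<open>Every point of \<open>L\<close> is some \<open>\<phi> i x\<close>, where both
    maps must take the value \<open>\<psi> i x\<close>. This gives uniqueness both among bijections
    and among homeomorphisms.\<close>
  have unique: "\<gamma> p = \<beta> p"
    if "\<forall>i. \<forall>x\<in>topspace (X i). \<psi> i x = \<beta> (\<phi> i x)" "\<forall>i. \<forall>x\<in>topspace (X i). \<psi> i x = \<gamma> (\<phi> i x)"
      "p \<in> topspace L" for \<beta> \<gamma> p
    using that by (force simp: limit_space_topspace[OF L])
  have "\<exists>!\<beta>. \<beta> \<in> extensional (topspace L) \<and> bij_betw \<beta> (topspace L) (topspace Z) \<and>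
               (\<forall>i. \<forall>x\<in>topspace (X i). \<psi> i x = \<beta> (\<phi> i x))"
  proof (rule ex_ex1I[OF limit_spaces_bijection_exists[OF cis L Z]], elim conjE)
    fix \<beta> \<gamma>
    assume "\<beta> \<in> extensional (topspace L)" "\<gamma> \<in> extensional (topspace L)"
      and "\<forall>i. \<forall>x\<in>topspace (X i). \<psi> i x = \<beta> (\<phi> i x)"
      and "\<forall>i. \<forall>x\<in>topspace (X i). \<psi> i x = \<gamma> (\<phi> i x)"
    then show "\<beta> = \<gamma>"
      by (intro extensionalityI[of \<beta> "topspace L"] unique)
  qed
  moreover have "homeomorphic_map L Z \<beta>"
    if "bij_betw \<beta> (topspace L) (topspace Z)"
      "\<forall>i. \<forall>x\<in>topspace (X i). \<psi> i x = \<beta> (\<phi> i x)" for \<beta>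
    using that by (intro fundamental_limit_spaces_homeomorphic_map[OF assms(2,3)]) simp_all
  ultimately show ?thesis
    by (intro conjI allI impI ballI) (use unique in simp_all)
qed

end
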